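(* Let $n$ be a non-negative integer and let $q,a,b,c,d,e$ be non-zero complex numbers, with $\sqrt a$ a fixed square root of $a$, satisfying $a^2q=bcdeq^{-n}$ and such that no denominator on either side below vanishes. Then $${}_8\phi_7\left[\begin{matrix} a,\ q\sqrt a,\ -q\sqrt a,\ b,\ c,\ d,\ e,\ q^{-n}\\ \sqrt a,\ -\sqrt a,\ aq/b,\ aq/c,\ aq/d,\ aq/e,\ aq^{n+1}\end{matrix};q,q\right]=\frac{(aq,\ aq/(bc),\ aq/(bd),\ aq/(cd);q)_n}{(aq/b,\ aq/c,\ aq/d,\ aq/(bcd);q)_n} .$$
   Context: For complex $a,q$ and a non-negative integer $n$, $(a;q)_n:=\prod_{k=0}^{n-1}(1-aq^k)$, with $(a;q)_0=1$, and $(a_1,\ldots,a_k;q)_n:=\prod_{i=1}^k (a_i;q)_n$. The unilateral basic hypergeometric series is $${}_{r+1}\phi_r\left[\begin{matrix} a_0,\ldots,a_r\\ b_1,\ldots,b_r\end{matrix};q,z\right]:=\sum_{j=0}^{\infty}\frac{(a_0,\ldots,a_r;q)_j}{(q,b_1,\ldots,b_r;q)_j}z^j .$$ When one numerator parameter is $q^{-n}$ the series terminates and is read as the finite sum over $0\le j\le n$ (so no convergence condition on $z$ is needed). *)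

theory Defs
  imports Complex_Main
begin

definition qpoch :: "complex \<Rightarrow> complex \<Rightarrow> nat \<Rightarrow> complex" where
  "qpoch a q n = (\<Prod>k<n. 1 - a * q ^ k)"

definition qpochs :: "complex list \<Rightarrow> complex \<Rightarrow> nat \<Rightarrow> complex" where
  "qpochs as q n = (\<Prod>a\<leftarrow>as. qpoch a q n)"

text \<open>
  The series \<open>\<^sub>r\<^sub>+\<^sub>1\<phi>\<^sub>r\<close>, for \<open>length as = length bs + 1\<close>. For other list lengths the usual
  definition carries an extra factor that is not included here.
\<close>
definition qhyp :: "complex list \<Rightarrow> complex list \<Rightarrow> complex \<Rightarrow> complex \<Rightarrow> complex" where
  "qhyp as bs q z = (\<Sum>j. qpochs as q j / qpochs (q # bs) q j * z ^ j)"

lemma qpoch_terminating: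
  assumes "q \<noteq> 0" "n < j"
  shows "qpoch (q powi (- int n)) q j = 0"
proof -
  have "1 - q powi (- int n) * q ^ n = 0"
    using assms(1) by (simp add: power_int_minus)
  then show ?thesis
    unfolding qpoch_def using assms(2) by (intro prod_zero) auto
qed

text \<open>
  If \<open>q\<^bsup>-n\<^esup>\<close> is a numerator parameter, then the series is the finite sum over \<open>j \<le> n\<close>: every later
  numerator is \<open>0\<close>, and so is the quotient, even where a later denominator vanishes,
  since \<open>0 / 0 = 0\<close>.
\<close>
lemma qhyp_terminating:
  assumes "q \<noteq> 0" "q powi (- int n) \<in> set as"
  shows "qhyp as bs q z = (\<Sum>j\<le>n. qpochs as q j / qpochs (q # bs) q j * z ^ j)"
proof -
  have "qpochs as q j = 0" if "n < j" for j
    using qpoch_terminating[OF assms(1) that] assms(2)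
    by (force simp: qpochs_def prod_list_zero_iff)
  then show ?thesis
    unfolding qhyp_def by (intro suminf_finite) auto
qed

end

theory Submission
  imports Defs
begin

text \<open>
  This is Jackson's summation of a terminating, very-well-poised, balanced \<open>\<^sub>8\<phi>\<^sub>7\<close>. Write
  \<open>f = q\<^bsup>-n\<^esup>\<close>. Since \<open>aq/f = aq\<^bsup>n+1\<^esup>\<close> and \<open>aq/a = q\<close>, all numerator parameters except \<open>\<plusminus>q\<surd>a\<close> play
  the same part: the summand is the product over \<open>x \<in> {a, b, c, d, e, f}\<close> of the quotients
  \<open>(x;q)\<^sub>k / (aq/x;q)\<^sub>k\<close>, times \<open>q\<^sup>k\<close> and the factor
  \<open>(1 - aq\<^bsup>2k\<^esup>) / (1 - a)\<close> that comes from \<open>\<plusminus>q\<surd>a\<close>.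

  Fix \<open>a, b, c, d\<close> and compare the sums for \<open>n\<close> and \<open>n + 1\<close>. If now \<open>f = q\<^bsup>-n-1\<^esup>\<close> and \<open>bcdef = a\<^sup>2\<close>, then
  the sum for \<open>n\<close> has the last two parameters \<open>(e, qf)\<close> and the sum for \<open>n + 1\<close> has \<open>(qe, f)\<close>.
  Both summands are multiples of the product \<open>W\<^sub>k\<close> of the six quotients with parameters
  \<open>(e, f)\<close>. On the other hand, \<open>W\<^sub>k (\<Prod>(1 - xq\<^sup>k) - \<Prod>(1 - aq\<^sup>k/x))\<close> is a difference
  \<open>G\<^bsub>k+1\<^esub> - G\<^sub>k\<close>, whose sum vanishes because the numerator contains \<open>1 - fq\<^bsup>n+1\<^esup> = 0\<close>. As
  \<open>abcdef = a\<^sup>3\<close>, the polynomial \<open>\<Prod>(1 - xy) - \<Prod>(1 - ay/x)\<close> vanishes at \<open>0\<close> and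
  is antisymmetric under \<open>y \<mapsto> 1/(ay)\<close> up to the factor \<open>a\<^sup>3 y\<^sup>6\<close>. Hence it is divisible by
  \<open>y (1 - ay\<^sup>2)\<close>, and the cofactor is a combination of the
  two quadratics \<open>(1 - ey)(1 - ay/e)\<close> and \<open>(1 - fy)(1 - ay/f)\<close> that distinguish the two summands
  (\<open>well_poised_difference\<close>). Summation over \<open>k\<close> gives a two-term relation between the two
  sums (\<open>contiguous_relation\<close>), which is the recurrence of the product on the right-hand side.

  The induction on \<open>n\<close> divides by quantities, such as \<open>1 - aq\<close>, that may vanish although all
  denominators in the final identity are non-zero. For given \<open>b, c, d, q, n\<close> there are only finitely
  many such \<open>a\<close>, and both sides are continuous at the given \<open>a\<close> when \<open>e\<close> is viewed as a
  function of \<open>a\<close>, so the identity extends to them (\<open>jackson_summation\<close>).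
\<close>

section \<open>The polynomial identity behind the telescoping\<close>

text \<open>
  The balancing condition turns the reciprocals \<open>a/b\<close>, \<open>a/c\<close>, \<open>a/d\<close> into monomials, so that both
  this cubic and \<open>(1 - by)(1 - cy)(1 - dy)\<close> depend on \<open>b, c, d\<close> only through the two quantities
  \<open>b + c + d\<close> and \<open>(bc + bd + cd)/a\<close>, and depend on them linearly.
\<close>

lemma reciprocal_cubic:
  fixes a b c d e f y :: complex
  assumes "b \<noteq> 0" "c \<noteq> 0" "d \<noteq> 0" "e \<noteq> 0" "f \<noteq> 0" "a \<noteq> 0" "b*c*d*e*f = a^2"
  shows "(1 - a*y/b) * (1 - a*y/c) * (1 - a*y/d) = 1 - e*f*((b*c+b*d+c*d)/a)*y + e*f*(b+c+d)*y^2 - a*e*f*y^3"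
proof -
  have ib: "a/b = c*d*e*f/a" and ic: "a/c = b*d*e*f/a" and id: "a/d = b*c*e*f/a"
    using assms by (auto simp: field_simps power2_eq_square)
  have 2: "a/b*(a/c) = d*e*f" "a/b*(a/d) = c*e*f" "a/c*(a/d) = b*e*f"
    and 3: "a/b*(a/c)*(a/d) = a*e*f"
    using assms(1-6) assms(7)[symmetric] by (auto simp: field_simps power2_eq_square)
  have expand: "(1 - A*y) * (1 - B*y) * (1 - C*y) = 1 - (A+B+C)*y + (A*B + A*C + B*C)*y^2 - (A*B*C)*y^3"
    for A B C :: complex
    by (simp add: algebra_simps power2_eq_square power3_eq_cube)
  have "(1 - a*y/b) * (1 - a*y/c) * (1 - a*y/d) = 1 - (a/b+a/c+a/d)*y + (a/b*(a/c) + a/b*(a/d) + a/c*(a/d))*y^2 - (a/b*(a/c)*(a/d))*y^3"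
    using expand[of "a/b" "a/c" "a/d"] by simp
  also have "\<dots> = 1 - e*f*((b*c+b*d+c*d)/a)*y + e*f*(b+c+d)*y^2 - a*e*f*y^3"
    unfolding 3 unfolding 2 unfolding ib ic id by (simp add: algebra_simps add_divide_distrib)
  finally show ?thesis .
qed

text \<open>
  The left-hand bracket is antisymmetric under \<open>y \<mapsto> 1/(ay)\<close> up to the factor \<open>a\<^sup>3 y\<^sup>6\<close>, which
  explains the factor \<open>1 - ay\<^sup>2\<close>. The remaining quadratic lies in a two-dimensional space, and
  its two coefficients are found by evaluation at \<open>y = 1/e\<close> and \<open>y = 1/f\<close>. The factor \<open>e - f\<close>
  clears the denominator that this evaluation creates.
\<close>
lemma well_poised_difference:
  fixes a b c d e f y :: complex
  defines "R \<equiv> \<lambda>y. (1 - a*y/b) * (1 - a*y/c) * (1 - a*y/d)"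
  assumes nz: "a \<noteq> 0" "b \<noteq> 0" "c \<noteq> 0" "d \<noteq> 0" "e \<noteq> 0" "f \<noteq> 0" and bal: "b*c*d*e*f = a^2"
  shows "(e - f) * ((1-a*y)*(1-b*y)*(1-c*y)*(1-d*y)*(1-e*y)*(1-f*y) - (1-y)*R y*(1-a*y/e)*(1-a*y/f))
   = y*(1-a*y^2) * (f*(f-1)*R (1/f)*((1-e*y)*(1-a*y/e)) - e*(e-1)*R (1/e)*((1-f*y)*(1-a*y/f)))"
proof -
  define u v where "u = a/e" and "v = a/f"
  define s1 where "s1 = b+c+d"
  define s where "s = (b*c+b*d+c*d)/a"
  have R: "R y = 1 - e*f*s*y + e*f*s1*y^2 - a*e*f*y^3" for y
    unfolding R_def s1_def s_def using nz bal by (intro reciprocal_cubic) auto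
  have "a\<^sup>2 / (e * f) = b*c*d"
    using bal nz by (simp add: field_simps)
  moreover have "(1-b*y)*(1-c*y)*(1-d*y) = 1 - s1*y + a*s*y^2 - b*c*d*y^3"
  proof -
    have "a * s = b*c+b*d+c*d" using nz by (simp add: s_def)
    then show ?thesis
      by (simp add: s1_def algebra_simps power2_eq_square power3_eq_cube)
  qed
  ultimately have P: "(1-b*y)*(1-c*y)*(1-d*y) = 1 - s1*y + a*s*y^2 - u*v*y^3"
    by (simp add: u_def v_def power2_eq_square)
  have uv: "u * e = a" "v * f = a" using nz by (simp_all add: u_def v_def)
  have Rf: "f * R (1/f) = f - e*f*s + e*s1 - e*v" and Re: "e * R (1/e) = e - e*f*s + f*s1 - f*u"
    unfolding R u_def v_def using nz by (simp_all add: field_simps power2_eq_square power3_eq_cube)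
  have "(e - f) * ((1-a*y)*(1 - s1*y + a*s*y^2 - u*v*y^3)*(1-e*y)*(1-f*y)
          - (1-y)*(1 - e*f*s*y + e*f*s1*y^2 - a*e*f*y^3)*(1-u*y)*(1-v*y))
    = y*(1-a*y^2) * ((f-1)*(f - e*f*s + e*s1 - e*v)*((1-e*y)*(1-u*y))
          - (e-1)*(e - e*f*s + f*s1 - f*u)*((1-f*y)*(1-v*y)))"
  proof -
    \<comment> \<open>The relation \<open>ue = vf\<close> has the polynomial parametrisation \<open>f = te\<close>, \<open>u = tv\<close>.\<close>
    define t where "t = f / e"
    have "f = t * e" "u = t * v" "a = t * v * e"
      using nz by (simp_all add: t_def u_def v_def)
    then show ?thesis by (simp add: algebra_simps power2_eq_square power3_eq_cube)
  qed
  moreover have "a*y/e = u*y" "a*y/f = v*y" by (simp_all add: u_def v_def)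
  moreover have "(1-a*y)*(1-b*y)*(1-c*y)*(1-d*y)*(1-e*y)*(1-f*y) = (1-a*y)*((1-b*y)*(1-c*y)*(1-d*y))*(1-e*y)*(1-f*y)"
    by (simp only: mult.assoc)
  moreover have "f*(f-1)*R (1/f) = (f-1)*(f*R (1/f))" "e*(e-1)*R (1/e) = (e-1)*(e*R (1/e))"
    by simp_all
  ultimately show ?thesis unfolding Rf Re P by (simp only: P R)
qed

section \<open>Well-poised quotients\<close>

lemma qpoch_0 [simp]: "qpoch a q 0 = 1"
  by (simp add: qpoch_def)

lemma qpoch_Suc: "qpoch a q (Suc k) = qpoch a q k * (1 - a * q ^ k)"
  by (simp add: qpoch_def)

lemma qpoch_shift: "qpoch (q * a) q k * (1 - a) = qpoch a q k * (1 - a * q ^ k)"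
proof (induction k)
  case (Suc k)
  have "qpoch (q * a) q (Suc k) * (1 - a) = (qpoch (q * a) q k * (1 - a)) * (1 - q * a * q ^ k)"
    by (simp add: qpoch_Suc ac_simps)
  then show ?case unfolding Suc.IH by (simp add: qpoch_Suc ac_simps)
qed simp

lemma qpoch_nonzero_iff: "qpoch a q n \<noteq> 0 \<longleftrightarrow> (\<forall>i<n. a * q ^ i \<noteq> 1)"
  by (auto simp: qpoch_def)

lemma qpoch_nonzero_mono: "qpoch a q n \<noteq> 0 \<Longrightarrow> k \<le> n \<Longrightarrow> qpoch a q k \<noteq> 0"
  by (auto simp: qpoch_nonzero_iff)

definition wp_ratio :: "complex \<Rightarrow> complex \<Rightarrow> complex \<Rightarrow> nat \<Rightarrow> complex" where
  "wp_ratio a q x k = qpoch x q k / qpoch (a * q / x) q k"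

lemma wp_ratio_Suc:
  assumes "qpoch (a * q / x) q (Suc k) \<noteq> 0"
  shows "wp_ratio a q x (Suc k) * (1 - a * q ^ Suc k / x) = wp_ratio a q x k * (1 - x * q ^ k)"
proof -
  have "1 - a * q ^ Suc k / x = 1 - a * q / x * q ^ k" by simp
  moreover have "N * u / (D * t) * t = N / D * u" if "D * t \<noteq> 0" for N u D t :: complex
    using that by simp
  ultimately show ?thesis using assms unfolding wp_ratio_def qpoch_Suc by metis
qed

text \<open>
  Replacing \<open>x\<close> by \<open>qx\<close> costs only the quadratic \<open>(1 - xy)(1 - ay/x)\<close> at \<open>y = q\<^sup>k\<close>,
  normalised by its value at \<open>y = 1\<close>.
\<close>
lemma wp_ratio_shift:
  assumes "q \<noteq> 0" "x \<noteq> 0" "x \<noteq> a" "qpoch (a * q / x) q k \<noteq> 0"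
  shows "wp_ratio a q (q * x) k * ((1 - x) * (1 - a / x))
           = wp_ratio a q x k * ((1 - x * q ^ k) * (1 - a * q ^ k / x))"
proof -
  have den: "qpoch (a * q / x) q k * (1 - a / x) = qpoch (a / x) q k * (1 - a * q ^ k / x)"
    using qpoch_shift[of q "a / x" k] by (simp add: mult.commute)
  have "1 - a / x \<noteq> 0" using assms by simp
  with den assms(4) have nz: "qpoch (a / x) q k \<noteq> 0" by auto
  have "wp_ratio a q (q * x) k * ((1 - x) * (1 - a / x))
      = (qpoch (q * x) q k * (1 - x)) * (1 - a / x) / qpoch (a / x) q k"
    using assms by (simp add: wp_ratio_def)
  also have "\<dots> = qpoch x q k * (1 - x * q ^ k) * ((1 - a / x) / qpoch (a / x) q k)"
    unfolding qpoch_shift by simp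
  also have "(1 - a / x) / qpoch (a / x) q k = (1 - a * q ^ k / x) / qpoch (a * q / x) q k"
    using den nz assms(4) by (simp add: frac_eq_eq mult.commute)
  finally show ?thesis by (simp add: wp_ratio_def)
qed

text \<open>
  The very-well-poised summand. The parameters \<open>\<plusminus>q\<surd>a\<close> over \<open>\<plusminus>\<surd>a\<close> have been contracted to
  \<open>(1 - aq\<^bsup>2k\<^esup>)/(1 - a)\<close>, so no square root of \<open>a\<close> occurs.
\<close>
definition vwp_term ::
  "complex \<Rightarrow> complex \<Rightarrow> complex \<Rightarrow> complex \<Rightarrow> complex \<Rightarrow> complex \<Rightarrow> complex \<Rightarrow> nat \<Rightarrow> complex" where
  "vwp_term a q b c d e f k = (1 - a * q ^ (2 * k)) / (1 - a) *
     (wp_ratio a q a k * wp_ratio a q b k * wp_ratio a q c k * wp_ratio a q d k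
       * wp_ratio a q e k * wp_ratio a q f k) * q ^ k"

text \<open>
  By \<open>wp_ratio_Suc\<close>, \<open>W (k + 1) V (q\<^bsup>k+1\<^esup>) = W k U (q\<^sup>k)\<close>, so the sum telescopes. There is no
  lower boundary term because \<open>V 1 = 0\<close>.
\<close>
lemma well_poised_telescope:
  fixes a q b c d e f :: complex
  defines "W \<equiv> \<lambda>k. wp_ratio a q a k * wp_ratio a q b k * wp_ratio a q c k * wp_ratio a q d k
       * wp_ratio a q e k * wp_ratio a q f k"
  defines "U \<equiv> \<lambda>y. (1-a*y)*(1-b*y)*(1-c*y)*(1-d*y)*(1-e*y)*(1-f*y)"
  defines "V \<equiv> \<lambda>y. (1-y)*((1-a*y/b)*(1-a*y/c)*(1-a*y/d))*(1-a*y/e)*(1-a*y/f)"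
  assumes "a \<noteq> 0" and nz: "\<forall>x\<in>{a, b, c, d, e, f}. qpoch (a * q / x) q N \<noteq> 0"
  shows "(\<Sum>k\<le>N. W k * (U (q ^ k) - V (q ^ k))) = W N * U (q ^ N)"
  using nz
proof (induction N)
  case 0
  then show ?case by (simp add: V_def)
next
  case (Suc N)
  have *: "wp_ratio a q x (Suc N) * (1 - a * q ^ Suc N / x) = wp_ratio a q x N * (1 - x * q ^ N)"
    if "x \<in> {a, b, c, d, e, f}" for x
    by (rule wp_ratio_Suc) (use Suc.prems that in blast)
  have "W (Suc N) * V (q ^ Suc N)
    = (wp_ratio a q a (Suc N) * (1 - a * q ^ Suc N / a)) * (wp_ratio a q b (Suc N) * (1 - a * q ^ Suc N / b))
      * (wp_ratio a q c (Suc N) * (1 - a * q ^ Suc N / c)) * (wp_ratio a q d (Suc N) * (1 - a * q ^ Suc N / d))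
      * (wp_ratio a q e (Suc N) * (1 - a * q ^ Suc N / e)) * (wp_ratio a q f (Suc N) * (1 - a * q ^ Suc N / f))"
    using \<open>a \<noteq> 0\<close> by (simp add: W_def V_def ac_simps del: power_Suc)
  also have "\<dots> = W N * U (q ^ N)"
    by (subst *, simp)+ (simp add: W_def U_def ac_simps)
  finally have step: "W (Suc N) * V (q ^ Suc N) = W N * U (q ^ N)" .
  have "\<forall>x\<in>{a, b, c, d, e, f}. qpoch (a * q / x) q N \<noteq> 0"
    using Suc.prems by (auto simp: qpoch_Suc)
  note IH = Suc.IH[OF this]
  have "(\<Sum>k\<le>Suc N. W k * (U (q ^ k) - V (q ^ k)))
      = W N * U (q ^ N) + (W (Suc N) * U (q ^ Suc N) - W (Suc N) * V (q ^ Suc N))"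
    by (simp only: sum.atMost_Suc right_diff_distrib[of "W (Suc N)"] IH)
  then show ?case unfolding step by (simp only: add_diff_cancel_left' add_diff_eq)
qed

section \<open>The contiguous relation\<close>

text \<open>
  With \<open>f q\<^sup>N = 1\<close> the telescoping sum has no upper boundary term either, hence vanishes. Its
  summand is a combination of the two very-well-poised summands with \<open>(e, f)\<close> replaced by
  \<open>(qe, f)\<close> and by \<open>(e, qf)\<close>.
\<close>
lemma contiguous_relation:
  fixes a b c d e f q :: complex
  defines "R \<equiv> \<lambda>y. (1 - a*y/b) * (1 - a*y/c) * (1 - a*y/d)"
  assumes nz: "q \<noteq> 0" "a \<noteq> 0" "b \<noteq> 0" "c \<noteq> 0" "d \<noteq> 0" "e \<noteq> 0" "f \<noteq> 0"
    and bal: "b*c*d*e*f = a^2" and fN: "f * q ^ N = 1"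
    and ne: "a \<noteq> 1" "e \<noteq> 1" "f \<noteq> 1" "e \<noteq> a" "f \<noteq> a"
    and den: "\<forall>x\<in>{a, b, c, d, e, f}. qpoch (a * q / x) q N \<noteq> 0"
  shows "f * R (1/f) * (1 - a/e) * (\<Sum>k\<le>N. vwp_term a q b c d (q * e) f k)
       = e * R (1/e) * (1 - a/f) * (\<Sum>k\<le>N. vwp_term a q b c d e (q * f) k)"
proof -
  define W where "W k = wp_ratio a q a k * wp_ratio a q b k * wp_ratio a q c k * wp_ratio a q d k
       * wp_ratio a q e k * wp_ratio a q f k" for k
  define U where "U y = (1-a*y)*(1-b*y)*(1-c*y)*(1-d*y)*(1-e*y)*(1-f*y)" for y
  define V where "V y = (1-y)*((1-a*y/b)*(1-a*y/c)*(1-a*y/d))*(1-a*y/e)*(1-a*y/f)" for y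
  define A where "A = f*(f-1)*R (1/f)"
  define B where "B = e*(e-1)*R (1/e)"
  have te: "vwp_term a q b c d (q * e) f k * ((1-e)*(1-a/e))
      = W k * (q^k*(1-a*(q^k)^2)) * ((1-e*q^k)*(1-a*q^k/e)) / (1-a)" if "k \<le> N" for k
  proof -
    have "qpoch (a * q / e) q k \<noteq> 0" using den by (intro qpoch_nonzero_mono[OF _ that]) simp
    from wp_ratio_shift[OF nz(1) nz(6) ne(4) this]
    show ?thesis by (simp add: vwp_term_def W_def power_mult[symmetric] mult.commute[of 2] ac_simps)
  qed
  have tf: "vwp_term a q b c d e (q * f) k * ((1-f)*(1-a/f))
      = W k * (q^k*(1-a*(q^k)^2)) * ((1-f*q^k)*(1-a*q^k/f)) / (1-a)" if "k \<le> N" for k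
  proof -
    have "qpoch (a * q / f) q k \<noteq> 0" using den by (intro qpoch_nonzero_mono[OF _ that]) simp
    from wp_ratio_shift[OF nz(1) nz(7) ne(5) this]
    show ?thesis by (simp add: vwp_term_def W_def power_mult[symmetric] mult.commute[of 2] ac_simps)
  qed
  have "A * ((1-e)*(1-a/e)) * (\<Sum>k\<le>N. vwp_term a q b c d (q * e) f k)
      - B * ((1-f)*(1-a/f)) * (\<Sum>k\<le>N. vwp_term a q b c d e (q * f) k)
      = (\<Sum>k\<le>N. A * (vwp_term a q b c d (q * e) f k * ((1-e)*(1-a/e)))
               - B * (vwp_term a q b c d e (q * f) k * ((1-f)*(1-a/f))))"
    by (simp add: sum_subtractf sum_distrib_left ac_simps)
  also have "\<dots> = (\<Sum>k\<le>N. (e-f)/(1-a) * (W k * (U (q^k) - V (q^k))))"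
  proof (rule sum.cong[OF refl], goal_cases)
    case (1 k)
    then have k: "k \<le> N" by simp
    have "(e - f) * (U (q^k) - V (q^k)) = q^k*(1-a*(q^k)^2) *
        (A * ((1-e*q^k)*(1-a*q^k/e)) - B * ((1-f*q^k)*(1-a*q^k/f)))"
      unfolding U_def V_def A_def B_def R_def using nz bal by (intro well_poised_difference)
    then have *: "(e-f)/(1-a) * (W k * (U (q^k) - V (q^k))) = W k / (1-a) * (q^k*(1-a*(q^k)^2) *
        (A * ((1-e*q^k)*(1-a*q^k/e)) - B * ((1-f*q^k)*(1-a*q^k/f))))"
      by simp
    have factor: "A * (w * y * E / r) - B * (w * y * F / r) = w / r * (y * (A * E - B * F))"
      for w y r E F :: complex
      by (simp add: diff_divide_distrib right_diff_distrib ac_simps)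
    show ?case unfolding te[OF k] tf[OF k] * by (rule factor)
  qed
  also have "\<dots> = (e-f)/(1-a) * (W N * U (q^N))"
    by (simp only: sum_distrib_left[symmetric] W_def U_def V_def well_poised_telescope[OF nz(2) den])
  also have "\<dots> = 0" using fN by (simp add: U_def)
  finally have eq0: "A * ((1-e)*(1-a/e)) * (\<Sum>k\<le>N. vwp_term a q b c d (q * e) f k)
      - B * ((1-f)*(1-a/f)) * (\<Sum>k\<le>N. vwp_term a q b c d e (q * f) k) = 0" .
  have "(1-e)*(f-1) * (f * R (1/f) * (1 - a/e) * (\<Sum>k\<le>N. vwp_term a q b c d (q * e) f k))
      = (1-e)*(f-1) * (e * R (1/e) * (1 - a/f) * (\<Sum>k\<le>N. vwp_term a q b c d e (q * f) k))"
  proof -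
    have sign: "(e-1)*(1-f) = (1-e)*(f-1)"
      by (simp add: algebra_simps)
    have "B * ((1-f)*(1-a/f)) * S = (1-e)*(f-1) * (e * R (1/e) * (1 - a/f) * S)" for S
      unfolding B_def sign[symmetric] by (simp only: ac_simps)
    moreover have "A * ((1-e)*(1-a/e)) * S = (1-e)*(f-1) * (f * R (1/f) * (1 - a/e) * S)" for S
      unfolding A_def by (simp only: ac_simps)
    ultimately show ?thesis using eq0 by (simp only: right_minus_eq)
  qed
  moreover have "(1-e)*(f-1) \<noteq> 0" using ne by simp
  ultimately show ?thesis by (simp only: mult_left_cancel not_False_eq_True)
qed

section \<open>Induction for generic parameters\<close>

definition jackson_rhs :: "complex \<Rightarrow> complex \<Rightarrow> complex \<Rightarrow> complex \<Rightarrow> complex \<Rightarrow> nat \<Rightarrow> complex" where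
  "jackson_rhs a q b c d n =
     qpochs [a * q, a * q / (b * c), a * q / (b * d), a * q / (c * d)] q n
       / qpochs [a * q / b, a * q / c, a * q / d, a * q / (b * c * d)] q n"

text \<open>
  Here \<open>e\<close> is eliminated by the balancing condition, so that the sum is a function of \<open>a\<close> for
  fixed \<open>b, c, d, q, n\<close>.
\<close>
definition jackson_lhs :: "complex \<Rightarrow> complex \<Rightarrow> complex \<Rightarrow> complex \<Rightarrow> complex \<Rightarrow> nat \<Rightarrow> complex" where
  "jackson_lhs a q b c d n = (\<Sum>k\<le>n. vwp_term a q b c d (a^2 * q ^ (n+1) / (b*c*d)) (1 / q ^ n) k)"

text \<open>
  The coefficients of the contiguous relation for \<open>f = 1/Q\<close>, \<open>Q = q\<^bsup>n+1\<^esup>\<close>: reversing each factor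
  \<open>1 - 1/z\<close> to \<open>-(1 - z)/z\<close> produces the same monomial on both sides, and what is left are
  the factors at index \<open>n\<close> of the \<open>q\<close>-Pochhammer symbols in \<open>jackson_rhs\<close>.
\<close>
lemma contiguous_relation_in_Q:
  fixes a b c d Q S S' :: complex
  defines "P \<equiv> a * Q" and "e \<equiv> a\<^sup>2 * Q / (b*c*d)"
  assumes nz: "a \<noteq> 0" "b \<noteq> 0" "c \<noteq> 0" "d \<noteq> 0" "Q \<noteq> 0"
  assumes eq: "1/Q * ((1 - a*Q/b) * (1 - a*Q/c) * (1 - a*Q/d)) * (1 - a/e) * S'
     = e * ((1 - a*(1/e)/b) * (1 - a*(1/e)/c) * (1 - a*(1/e)/d)) * (1 - a*Q) * S"
  shows "(1 - P/b) * (1 - P/c) * (1 - P/d) * (1 - P/(b*c*d)) * S'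
     = (1 - P) * (1 - P/(b*c)) * (1 - P/(b*d)) * (1 - P/(c*d)) * S"
proof -
  have P: "P \<noteq> 0" using nz by (simp add: P_def)
  have 1: "1/Q * (1 - a/e) = - (a*b*c*d/P^2) * (1 - P/(b*c*d))"
    using nz by (simp add: e_def P_def field_simps power2_eq_square)
  have "1 - a*(1/e)/b = -(c*d/P) * (1 - P/(c*d))" "1 - a*(1/e)/c = -(b*d/P) * (1 - P/(b*d))"
       "1 - a*(1/e)/d = -(b*c/P) * (1 - P/(b*c))"
    using nz by (simp_all add: e_def P_def field_simps power2_eq_square)
  then have "e * ((1 - a*(1/e)/b) * (1 - a*(1/e)/c) * (1 - a*(1/e)/d))
     = e * (-(c*d/P) * (-(b*d/P)) * (-(b*c/P))) * ((1 - P/(b*c)) * (1 - P/(b*d)) * (1 - P/(c*d)))"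
    by (simp add: ac_simps)
  also have "e * (-(c*d/P) * (-(b*d/P)) * (-(b*c/P))) = - (a*b*c*d/P^2)"
    using nz by (simp add: e_def P_def field_simps power2_eq_square)
  finally have 2: "e * ((1 - a*(1/e)/b) * (1 - a*(1/e)/c) * (1 - a*(1/e)/d))
     = - (a*b*c*d/P^2) * ((1 - P/(b*c)) * (1 - P/(b*d)) * (1 - P/(c*d)))" .
  have "- (a*b*c*d/P^2) * ((1 - P/b) * (1 - P/c) * (1 - P/d) * (1 - P/(b*c*d)) * S')
     = (1/Q * (1 - a/e)) * ((1 - P/b) * (1 - P/c) * (1 - P/d)) * S'"
    unfolding 1 by (simp only: ac_simps)
  also have "\<dots> = e * ((1 - a*(1/e)/b) * (1 - a*(1/e)/c) * (1 - a*(1/e)/d)) * (1 - P) * S"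
    using eq by (simp only: P_def ac_simps)
  also have "\<dots> = - (a*b*c*d/P^2) * ((1 - P) * (1 - P/(b*c)) * (1 - P/(b*d)) * (1 - P/(c*d)) * S)"
    unfolding 2 by (simp only: ac_simps)
  finally show ?thesis using nz P by simp
qed

lemma jackson_rhs_Suc:
  fixes a q b c d :: complex and n
  defines "P \<equiv> a * q ^ Suc n"
  shows "jackson_rhs a q b c d (Suc n) = jackson_rhs a q b c d n *
    ((1 - P) * (1 - P/(b*c)) * (1 - P/(b*d)) * (1 - P/(c*d)))
      / ((1 - P/b) * (1 - P/c) * (1 - P/d) * (1 - P/(b*c*d)))"
  unfolding jackson_rhs_def P_def by (simp add: qpochs_def qpoch_Suc ac_simps)

text \<open>
  The inequations hold for all smaller \<open>n\<close> as well and exclude every zero of a denominator or of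
  a factor cancelled in one of the \<open>n\<close> induction steps. The one on \<open>a\<^sup>2 q\<^sup>i\<close> says that the
  intermediate values of \<open>e\<close> differ from \<open>1\<close>.
\<close>
lemma jackson_generic:
  assumes nz: "q \<noteq> 0" "a \<noteq> 0" "b \<noteq> 0" "c \<noteq> 0" "d \<noteq> 0"
    and "\<forall>i\<le>2*n. a * q^i \<noteq> 1" "\<forall>i\<le>n. a * q^i \<noteq> b*c*d" "\<forall>i\<le>n. a^2 * q^i \<noteq> b*c*d"
    and "\<forall>i\<in>{1..n}. q^i \<noteq> 1 \<and> a * q^i \<noteq> b \<and> a * q^i \<noteq> c \<and> a * q^i \<noteq> d"
  shows "jackson_lhs a q b c d n = jackson_rhs a q b c d n"
  using assms(6-)
proof (induction n)
  case 0
  then show ?case by (simp add: jackson_lhs_def jackson_rhs_def vwp_term_def wp_ratio_def qpochs_def)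
next
  case (Suc n)
  define Q where "Q = q ^ Suc n"
  define e where "e = a\<^sup>2 * Q / (b*c*d)"
  define f where "f = 1 / Q"
  have Q: "Q \<noteq> 0" using nz by (simp add: Q_def)
  have ef: "e \<noteq> 0" "f \<noteq> 0" using nz Q by (simp_all add: e_def f_def)
  have aQ: "a * Q \<noteq> 1" "a * Q \<noteq> b*c*d" "a\<^sup>2 * Q \<noteq> b*c*d" "Q \<noteq> 1" "a * Q \<noteq> b" "a * Q \<noteq> c" "a * Q \<noteq> d"
    unfolding Q_def using Suc.prems(1)[rule_format, of "Suc n"] Suc.prems(2)[rule_format, of "Suc n"]
      Suc.prems(3)[rule_format, of "Suc n"] Suc.prems(4)[rule_format, of "Suc n"]
    by (simp_all del: power_Suc)
  have ne: "a \<noteq> 1" "e \<noteq> 1" "f \<noteq> 1" "e \<noteq> a" "f \<noteq> a"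
  proof -
    show "a \<noteq> 1" using Suc.prems(1) by (auto dest: spec[of _ 0])
    show "e \<noteq> 1" using nz aQ by (simp add: e_def field_simps)
    show "f \<noteq> 1" using aQ by (simp add: f_def)
    show "e \<noteq> a" using nz aQ by (auto simp add: e_def field_simps power2_eq_square)
    show "f \<noteq> a" using aQ Q by (auto simp add: f_def field_simps)
  qed
  have den: "qpoch (a * q / x) q (Suc n) \<noteq> 0" if "x \<in> {a, b, c, d, e, f}" for x
    unfolding qpoch_nonzero_iff
  proof (intro allI impI)
    fix i assume i: "i < Suc n"
    have split: "Q = q ^ Suc i * q ^ (n - i)"
      unfolding Q_def power_add[symmetric] using i by simp
    have "q ^ Suc i \<noteq> 1" "a * q ^ Suc i \<noteq> b" "a * q ^ Suc i \<noteq> c" "a * q ^ Suc i \<noteq> d"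
      using Suc.prems(4) i by (auto dest!: bspec[of _ _ "Suc i"] simp del: power_Suc)
    moreover have "a * q ^ Suc i \<noteq> e"
    proof
      assume "a * q ^ Suc i = e"
      then have "q ^ Suc i * (a * q ^ (n - i)) = q ^ Suc i * (b*c*d)"
        using nz unfolding e_def split by (simp add: field_simps power2_eq_square del: power_Suc)
      then have "a * q ^ (n - i) = b*c*d" using nz by simp
      moreover have "n - i \<le> Suc n" by simp
      ultimately show False using Suc.prems(2) by blast
    qed
    moreover have "a * q ^ Suc i \<noteq> f"
    proof
      assume "a * q ^ Suc i = f"
      then have "a * q ^ (Suc i + Suc n) = 1"
        unfolding power_add mult.assoc[symmetric] using Q by (simp add: f_def Q_def del: power_Suc)
      moreover have "Suc i + Suc n \<le> 2 * Suc n" using i by simp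
      ultimately show False using Suc.prems(1) by blast
    qed
    ultimately show "a * q / x * q ^ i \<noteq> 1"
      using that nz ef by (auto simp: field_simps)
  qed
  have fN: "f * q ^ Suc n = 1" using Q by (simp add: f_def Q_def del: power_Suc)
  have bal: "b*c*d*e*f = a\<^sup>2" using nz Q by (simp add: e_def f_def)
  have "qpoch (q * f) q (Suc n) = 0"
    using fN by (simp add: qpoch_Suc ac_simps)
  then have last: "vwp_term a q b c d e (q * f) (Suc n) = 0"
    by (simp add: vwp_term_def wp_ratio_def)
  \<comment> \<open>The sum for \<open>n\<close> may be extended to \<open>n + 1\<close>, so both sums have the same range.\<close>
  have L: "jackson_lhs a q b c d n = (\<Sum>k\<le>Suc n. vwp_term a q b c d e (q * f) k)"
    using last nz by (simp add: jackson_lhs_def e_def f_def Q_def)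
  have L': "jackson_lhs a q b c d (Suc n) = (\<Sum>k\<le>Suc n. vwp_term a q b c d (q * e) f k)"
    unfolding jackson_lhs_def e_def f_def Q_def by (simp add: ac_simps)
  have recurrence: "(1 - a*Q/b) * (1 - a*Q/c) * (1 - a*Q/d) * (1 - a*Q/(b*c*d)) * jackson_lhs a q b c d (Suc n)
     = (1 - a*Q) * (1 - a*Q/(b*c)) * (1 - a*Q/(b*d)) * (1 - a*Q/(c*d)) * jackson_lhs a q b c d n"
  proof (rule contiguous_relation_in_Q)
    show "1/Q * ((1 - a*Q/b) * (1 - a*Q/c) * (1 - a*Q/d)) * (1 - a/(a\<^sup>2*Q/(b*c*d))) * jackson_lhs a q b c d (Suc n)
     = (a\<^sup>2*Q/(b*c*d)) * ((1 - a*(1/(a\<^sup>2*Q/(b*c*d)))/b) * (1 - a*(1/(a\<^sup>2*Q/(b*c*d)))/c) * (1 - a*(1/(a\<^sup>2*Q/(b*c*d)))/d)) * (1 - a*Q) * jackson_lhs a q b c d n"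
      using contiguous_relation[OF nz ef bal fN ne] den unfolding L L' e_def[symmetric]
      by (simp add: f_def)
  qed (use nz Q in auto)
  have IH: "jackson_lhs a q b c d n = jackson_rhs a q b c d n"
    using Suc.prems by (intro Suc.IH) auto
  have nonzero: "(1 - a*Q/b) * (1 - a*Q/c) * (1 - a*Q/d) * (1 - a*Q/(b*c*d)) \<noteq> 0"
  proof -
    have "1 - a*Q/b \<noteq> 0" "1 - a*Q/c \<noteq> 0" "1 - a*Q/d \<noteq> 0" "1 - a*Q/(b*c*d) \<noteq> 0"
      using aQ nz by simp_all
    then show ?thesis by simp
  qed
  have solve: "L' = r * y / x" if "x * L' = y * L" "L = r" "x \<noteq> 0" for L' L r x y :: complex
    using that by (simp add: nonzero_eq_divide_eq mult.commute)
  show ?case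
    unfolding jackson_rhs_Suc Q_def[symmetric] using recurrence IH nonzero by (rule solve)
qed

section \<open>Extension to all parameters by continuity\<close>

lemma finite_power2_eq: "finite {x::complex. x\<^sup>2 = r}"
proof -
  have "{x::complex. x\<^sup>2 = r} \<subseteq> {csqrt r, - csqrt r}"
    using power2_eq_iff[of _ "csqrt r"] by auto
  then show ?thesis by (rule finite_subset) simp
qed

lemma eventually_mult_neq:
  fixes l r u :: "complex"
  assumes "l \<noteq> 0"
  shows "\<forall>\<^sub>F x in at u. x * l \<noteq> r" "\<forall>\<^sub>F x in at u. x\<^sup>2 * l \<noteq> r"
proof -
  have fin: "\<forall>\<^sub>F x in at u. x \<notin> S" if "finite S" for S :: "complex set"
  proof -
    have "\<forall>\<^sub>F x in at u. \<forall>z\<in>S. x \<noteq> z"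
      using that by (intro eventually_ball_finite) (auto simp: eventually_neq_at_within)
    then show ?thesis by (rule eventually_mono) auto
  qed
  from fin[of "{r / l}"] show "\<forall>\<^sub>F x in at u. x * l \<noteq> r"
    using assms by (auto elim!: eventually_mono simp: field_simps)
  from fin[OF finite_power2_eq[of "r / l"]] show "\<forall>\<^sub>F x in at u. x\<^sup>2 * l \<noteq> r"
    using assms by (auto elim!: eventually_mono simp: field_simps)
qed

lemma tendsto_qpoch [tendsto_intros]:
  "(g \<longlongrightarrow> l) F \<Longrightarrow> ((\<lambda>x. qpoch (g x) q k) \<longlongrightarrow> qpoch l q k) F"
  unfolding qpoch_def by (intro tendsto_intros)

text \<open>
  In a punctured neighbourhood of \<open>a\<close> the generic identity applies, and both sides are continuous
  at \<open>a\<close> since only the denominators of the identity itself have to be non-zero there.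
\<close>
lemma jackson_summation:
  assumes nz: "q \<noteq> 0" "a \<noteq> 0" "b \<noteq> 0" "c \<noteq> 0" "d \<noteq> 0" and "a \<noteq> 1"
    and den: "\<forall>x\<in>{q, a*q/b, a*q/c, a*q/d, a*q/(b*c*d), a*q/(a^2 * q^(n+1) / (b*c*d)), a*q/(1/q^n)}. qpoch x q n \<noteq> 0"
  shows "jackson_lhs a q b c d n = jackson_rhs a q b c d n"
proof (rule tendsto_unique[of "at a"])
  show "((\<lambda>x. jackson_lhs x q b c d n) \<longlongrightarrow> jackson_lhs a q b c d n) (at a)"
    unfolding jackson_lhs_def vwp_term_def wp_ratio_def
    by (intro tendsto_intros) (use assms qpoch_nonzero_mono[of _ q n] in auto)
  show "((\<lambda>x. jackson_lhs x q b c d n) \<longlongrightarrow> jackson_rhs a q b c d n) (at a)"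
  proof (rule Lim_transform_eventually)
    show "((\<lambda>x. jackson_rhs x q b c d n) \<longlongrightarrow> jackson_rhs a q b c d n) (at a)"
      unfolding jackson_rhs_def qpochs_def list.map prod_list.Cons prod_list.Nil
      by (intro tendsto_intros) (use assms in auto)
    \<comment> \<open>The genericity condition that does not involve \<open>x\<close>.\<close>
    have q: "q ^ i \<noteq> 1" if "i \<in> {1..n}" for i
    proof -
      have "\<forall>j<n. q * q ^ j \<noteq> 1"
        using den by (simp add: qpoch_nonzero_iff[symmetric])
      moreover have "i - 1 < n" "q * q ^ (i - 1) = q ^ i"
        using that by (auto simp flip: power_Suc)
      ultimately show ?thesis by metis
    qed
    have "\<forall>\<^sub>F x in at a. x \<noteq> 0"
      using eventually_mult_neq(1)[of 1 0 a] by simp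
    moreover have "\<forall>\<^sub>F x in at a. \<forall>i\<in>{..2*n}. x * q^i \<noteq> 1"
      "\<forall>\<^sub>F x in at a. \<forall>i\<in>{..n}. x * q^i \<noteq> b*c*d" "\<forall>\<^sub>F x in at a. \<forall>i\<in>{..n}. x^2 * q^i \<noteq> b*c*d"
      "\<forall>\<^sub>F x in at a. \<forall>i\<in>{1..n}. x * q^i \<noteq> b \<and> x * q^i \<noteq> c \<and> x * q^i \<noteq> d"
      using nz by (intro eventually_ball_finite eventually_conj ballI eventually_mult_neq finite_atMost
        finite_atLeastAtMost; simp)+
    ultimately show "\<forall>\<^sub>F x in at a. jackson_rhs x q b c d n = jackson_lhs x q b c d n"
    proof eventually_elim
      case (elim x)
      then show ?case using nz q by (intro jackson_generic[symmetric]) auto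
    qed
  qed
qed simp

section \<open>The series in hypergeometric notation\<close>

lemma vwp_factor:
  assumes "s\<^sup>2 \<noteq> 1" "qpoch s q k \<noteq> 0" "qpoch (- s) q k \<noteq> 0"
  shows "qpoch (q * s) q k * qpoch (- q * s) q k / (qpoch s q k * qpoch (- s) q k)
      = (1 - s\<^sup>2 * q ^ (2 * k)) / (1 - s\<^sup>2)"
proof -
  have "(qpoch (q * s) q k * (1 - s)) * (qpoch (q * - s) q k * (1 - - s))
      = (qpoch s q k * (1 - s * q ^ k)) * (qpoch (- s) q k * (1 - - s * q ^ k))"
    unfolding qpoch_shift ..
  then have "qpoch (q * s) q k * qpoch (- q * s) q k * (1 - s\<^sup>2)
     = (1 - s\<^sup>2 * q ^ (2 * k)) * (qpoch s q k * qpoch (- s) q k)"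
    by (simp add: algebra_simps power2_eq_square power_mult)
  then show ?thesis using assms by (simp add: frac_eq_eq)
qed

theorem theorem1p8:
  fixes n :: nat and q a b c d e sqrta :: complex
  assumes "q \<noteq> 0" "a \<noteq> 0" "b \<noteq> 0" "c \<noteq> 0" "d \<noteq> 0" "e \<noteq> 0"
    and "sqrta ^ 2 = a"
    and "a ^ 2 * q = b * c * d * e * q powi (- int n)"
    and "\<forall>j\<le>n. qpochs [q, sqrta, - sqrta, a * q / b, a * q / c, a * q / d, a * q / e, a * q ^ (n + 1)] q j \<noteq> 0"
    and "qpochs [a * q / b, a * q / c, a * q / d, a * q / (b * c * d)] q n \<noteq> 0"
  shows "qhyp [a, q * sqrta, - q * sqrta, b, c, d, e, q powi (- int n)]
              [sqrta, - sqrta, a * q / b, a * q / c, a * q / d, a * q / e, a * q ^ (n + 1)] q q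
       = qpochs [a * q, a * q / (b * c), a * q / (b * d), a * q / (c * d)] q n
         / qpochs [a * q / b, a * q / c, a * q / d, a * q / (b * c * d)] q n"
proof (cases "n = 0")
  \<comment> \<open>This case is separate because for \<open>n = 0\<close> the hypotheses allow \<open>a = 1\<close>.\<close>
  case True
  with assms(1) show ?thesis by (subst qhyp_terminating[where n = n]) (auto simp: qpochs_def)
next
  case False
  define f where "f = 1 / q ^ n"
  have qn: "q powi (- int n) = f" by (simp add: f_def power_int_minus divide_inverse)
  have e: "e = a\<^sup>2 * q ^ (n+1) / (b*c*d)"
    using assms(1-6,8) unfolding qn f_def by (simp add: field_simps)
  have den: "qpoch x q j \<noteq> 0" if "j \<le> n"
    "x \<in> {q, sqrta, - sqrta, a * q / b, a * q / c, a * q / d, a * q / e, a * q ^ (n + 1)}" for x j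
    using assms(9) that by (auto simp: qpochs_def)
  have aqf: "a * q / f = a * q ^ (n + 1)" by (simp add: f_def)
  have "qpoch sqrta q 1 \<noteq> 0" "qpoch (- sqrta) q 1 \<noteq> 0"
    using False by (intro den; simp)+
  then have "sqrta\<^sup>2 \<noteq> 1" by (auto simp: qpoch_Suc power2_eq_1_iff)
  have "qhyp [a, q * sqrta, - q * sqrta, b, c, d, e, f]
              [sqrta, - sqrta, a * q / b, a * q / c, a * q / d, a * q / e, a * q ^ (n + 1)] q q
     = (\<Sum>j\<le>n. vwp_term a q b c d e f j)"
  proof (subst qhyp_terminating[where n = n], goal_cases)
    case 3
    show ?case
    proof (rule sum.cong[OF refl], goal_cases)
      case (1 j)
      then have "qpoch (q * sqrta) q j * qpoch (- q * sqrta) q j / (qpoch sqrta q j * qpoch (- sqrta) q j)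
        = (1 - a * q ^ (2 * j)) / (1 - a)"
        using vwp_factor[OF \<open>sqrta\<^sup>2 \<noteq> 1\<close>, of q j] den assms(7) by auto
      then have "vwp_term a q b c d e f j
          = qpoch (q * sqrta) q j * qpoch (- q * sqrta) q j / (qpoch sqrta q j * qpoch (- sqrta) q j)
            * (wp_ratio a q a j * wp_ratio a q b j * wp_ratio a q c j * wp_ratio a q d j
                * wp_ratio a q e j * wp_ratio a q f j) * q ^ j"
        unfolding vwp_term_def by simp
      then show ?case unfolding wp_ratio_def aqf qpochs_def
        using assms(2) by (simp add: ac_simps)
    qed
  qed (use assms(1) qn in auto)
  also have "\<dots> = jackson_lhs a q b c d n" by (simp add: jackson_lhs_def e f_def)
  also have "\<dots> = jackson_rhs a q b c d n"
    using assms(1-5,7,10) den[of n] \<open>sqrta\<^sup>2 \<noteq> 1\<close> aqf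
    by (intro jackson_summation) (auto simp: e[simplified, symmetric] f_def qpochs_def)
  finally show ?thesis by (simp add: qn jackson_rhs_def)
qed

end
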